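(* As formal power series, $$\widetilde D(u,v,x)=\sum_{k\ge0}\frac{(uv(x^2+x))^k}{k!^2}\,\psi_{k+1}(ux)\,\psi_{k+1}(vx),$$ where $\psi_{k+1}(z)=\frac{d^k}{dz^k}\left(\frac{e^z-1}{z}\right)$.
   Context: The Delannoy polynomial $D_{a,b}(x)$ is the sum, over all lattice paths from $(0,0)$ to $(a,b)$ using steps $(0,1)$, $(1,0)$, $(1,1)$, of $x^{\text{number of steps}}$. Define $\widetilde D(u,v,x)=\sum_{a,b\ge0}\frac{D_{a,b}(x)\,u^{a+1}v^{b+1}}{(a+1)!\,(b+1)!}$.
   Formalization: The right-hand side is multiplied by uv: as printed the identity fails, since the left side has constant term 0 while the k=0 summand on the right has constant term 1. *)

theory Defs
  imports "HOL-Computational_Algebra.Computational_Algebra"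
begin

definition delannoy_paths :: "nat \<Rightarrow> nat \<Rightarrow> (nat \<times> nat) list set" where
  "delannoy_paths a b =
     {p. set p \<subseteq> {(0,1), (1,0), (1,1)} \<and> sum_list (map fst p) = a \<and> sum_list (map snd p) = b}"

text \<open>The sum below ranges over a finite set, so it is not subject to the convention that
  sums over infinite sets are zero.\<close>

lemma finite_delannoy_paths: "finite (delannoy_paths a b)"
proof -
  have len: "length p \<le> sum_list (map fst p) + sum_list (map snd p)"
    if "set p \<subseteq> {(0,1), (1,0), (1,1)}" for p :: "(nat \<times> nat) list"
    using that by (induction p) auto
  have "delannoy_paths a b \<subseteq> {p. set p \<subseteq> {(0,1), (1,0), (1,1)} \<and> length p \<le> a + b}"
    using len by (fastforce simp: delannoy_paths_def)
  then show ?thesis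
    by (rule finite_subset) (intro finite_lists_length_le, simp)
qed

definition delannoy_poly :: "nat \<Rightarrow> nat \<Rightarrow> 'a::comm_semiring_1 poly" where
  "delannoy_poly a b = (\<Sum>p\<in>delannoy_paths a b. monom 1 (length p))"

text \<open>Power series in \<open>u\<close>, \<open>v\<close> with coefficients polynomial in \<open>x\<close> have type \<open>'a poly fps fps\<close>:
  the outer series variable is \<open>u\<close>, the inner one is \<open>v\<close>, and \<open>x\<close> is the polynomial
  variable.  Convergence of series in this type is with respect to the \<open>u\<close>-adic metric of the
  library, which is finer than coefficientwise convergence.\<close>

definition var_u :: "'a::comm_semiring_1 poly fps fps" where
  "var_u = fps_X"

definition var_v :: "'a::comm_semiring_1 poly fps fps" where
  "var_v = fps_const fps_X"

definition var_x :: "'a::comm_semiring_1 poly fps fps" where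
  "var_x = fps_const (fps_const [:0, 1:])"

definition scalar :: "'a::zero \<Rightarrow> 'a poly fps fps" where
  "scalar c = fps_const (fps_const [:c:])"

text \<open>A series in one variable over the polynomials in \<open>x\<close>, read as a series in \<open>u\<close> or in \<open>v\<close>.\<close>

definition series_in_u :: "'b::zero fps \<Rightarrow> 'b fps fps" where
  "series_in_u f = Abs_fps (\<lambda>n. fps_const (fps_nth f n))"

definition series_in_v :: "'b::zero fps \<Rightarrow> 'b fps fps" where
  "series_in_v f = fps_const f"

text \<open>The coefficient of \<open>u ^ (a + 1) * v ^ (b + 1)\<close> is the Delannoy polynomial of \<open>(a, b)\<close>
  divided by \<open>(a + 1)! (b + 1)!\<close>; no other monomials occur.\<close>

definition delannoy_series :: "'a::field_char_0 poly fps fps" where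
  "delannoy_series = Abs_fps (\<lambda>i. Abs_fps (\<lambda>j.
     if i = 0 \<or> j = 0 then 0
     else smult (1 / (fact i * fact j)) (delannoy_poly (i - 1) (j - 1))))"

text \<open>Meaningful for \<open>m \<ge> 1\<close> only.\<close>

definition psi :: "nat \<Rightarrow> 'a::field_char_0 fps" where
  "psi m = fps_nth_deriv (m - 1) ((fps_exp 1 - 1) / fps_X)"

text \<open>The series \<open>psi m (w x)\<close> in one variable \<open>w\<close>, with coefficients polynomial in \<open>x\<close>.\<close>

definition psi_scaled :: "nat \<Rightarrow> 'a::field_char_0 poly fps" where
  "psi_scaled m = Abs_fps (\<lambda>n. [:fps_nth (psi m) n:]) oo (fps_X * fps_const [:0, 1:])"

end

theory Submission
  imports Defs
begin

text \<open>Comparing coefficients reduces the claim to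
  \<open>D\<^sub>a\<^sub>,\<^sub>b(x) = (\<Sum>k. (a choose k) * (b choose k) * (x\<^sup>2 + x) ^ k * x ^ (a - k) * x ^ (b - k))\<close>,
  since the coefficient of \<open>z ^ n\<close> in \<open>\<psi>\<^sub>k\<^sub>+\<^sub>1\<close> is \<open>1 / (n! (n + k + 1))\<close>.  Both sides of this
  formula satisfy the recurrence given by the first step of a path.  For the right-hand side, the
  defect in the recurrence telescopes in \<open>k\<close>.\<close>

subsection \<open>Recurrence for Delannoy polynomials\<close>

lemma delannoy_paths_0_0: "delannoy_paths 0 0 = {[]}"
proof -
  have "p = []" if "p \<in> delannoy_paths 0 0" for p
    using that by (cases p) (auto simp: delannoy_paths_def)
  then show ?thesis
    by (auto simp: delannoy_paths_def)
qed

lemma delannoy_paths_Suc_0: "delannoy_paths (Suc a) 0 = (#) (1, 0) ` delannoy_paths a 0"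
proof (intro equalityI subsetI)
  fix p assume "p \<in> delannoy_paths (Suc a) 0"
  then show "p \<in> (#) (1, 0) ` delannoy_paths a 0"
    by (cases p) (auto simp: delannoy_paths_def)
qed (auto simp: delannoy_paths_def)

lemma delannoy_paths_0_Suc: "delannoy_paths 0 (Suc b) = (#) (0, 1) ` delannoy_paths 0 b"
proof (intro equalityI subsetI)
  fix p assume "p \<in> delannoy_paths 0 (Suc b)"
  then show "p \<in> (#) (0, 1) ` delannoy_paths 0 b"
    by (cases p) (auto simp: delannoy_paths_def)
qed (auto simp: delannoy_paths_def)

lemma delannoy_paths_Suc_Suc:
  "delannoy_paths (Suc a) (Suc b) =
     (#) (1, 0) ` delannoy_paths a (Suc b) \<union> (#) (0, 1) ` delannoy_paths (Suc a) b \<union>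
     (#) (1, 1) ` delannoy_paths a b" (is "_ = ?R")
proof (intro equalityI subsetI)
  fix p assume "p \<in> delannoy_paths (Suc a) (Suc b)"
  then show "p \<in> ?R"
    by (cases p) (auto simp: delannoy_paths_def)
qed (auto simp: delannoy_paths_def)

text \<open>Prepending a step is injective and lengthens each path by one, which costs one factor
  x.\<close>

lemma sum_monom_length_Cons:
  "(\<Sum>p\<in>(#) s ` A. monom (1::'a::comm_semiring_1) (length p)) =
     [:0, 1:] * (\<Sum>p\<in>A. monom 1 (length p))"
  by (simp add: sum.reindex sum_distrib_left monom_Suc)

lemma delannoy_poly_0_0: "delannoy_poly 0 0 = 1"
  by (simp add: delannoy_poly_def delannoy_paths_0_0)

lemma delannoy_poly_Suc_0: "delannoy_poly (Suc a) 0 = [:0, 1:] * delannoy_poly a 0"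
  by (simp only: delannoy_poly_def delannoy_paths_Suc_0 sum_monom_length_Cons)

lemma delannoy_poly_0_Suc: "delannoy_poly 0 (Suc b) = [:0, 1:] * delannoy_poly 0 b"
  by (simp only: delannoy_poly_def delannoy_paths_0_Suc sum_monom_length_Cons)

lemma delannoy_poly_Suc_Suc:
  "delannoy_poly (Suc a) (Suc b) =
     [:0, 1:] * (delannoy_poly a (Suc b) + delannoy_poly (Suc a) b + delannoy_poly a b)"
  unfolding delannoy_poly_def delannoy_paths_Suc_Suc
  \<comment> \<open>The three images are disjoint because their paths begin with different
    steps.\<close>
  by (subst sum.union_disjoint, force simp: finite_delannoy_paths,
      force simp: finite_delannoy_paths, force)+
    (simp only: sum_monom_length_Cons distrib_left)

subsection \<open>Closed form\<close>

text \<open>This is the coefficient of t^k in (x + t)^a. Truncated subtraction in the exponent is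
  harmless: for \<open>a < k\<close> the binomial coefficient vanishes.\<close>

definition binom_monom :: "nat \<Rightarrow> nat \<Rightarrow> 'a::comm_semiring_1 poly" where
  "binom_monom a k = of_nat (a choose k) * [:0, 1:] ^ (a - k)"

lemma binom_monom_eq_0: "a < k \<Longrightarrow> binom_monom a k = 0"
  by (simp add: binom_monom_def binomial_eq_0)

lemma binom_monom_0_right: "binom_monom a 0 = [:0, 1:] ^ a"
  by (simp add: binom_monom_def)

text \<open>Pascal's rule, or coefficient comparison in (x + t)^(a + 1) = (x + t) (x + t)^a.\<close>

lemma binom_monom_Suc_Suc:
  "binom_monom (Suc a) (Suc k) = [:0, 1:] * binom_monom a (Suc k) + binom_monom a k"
proof (cases "k < a")
  case True
  then have "a - k = Suc (a - Suc k)"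
    by simp
  then show ?thesis
    by (simp only: binom_monom_def binomial_Suc_Suc diff_Suc_Suc of_nat_add power_Suc
        distrib_left distrib_right ac_simps)
next
  case False
  then show ?thesis
    by (simp add: binom_monom_def binomial_eq_0)
qed

text \<open>The cut-off \<open>N\<close> is independent of \<open>a\<close> and \<open>b\<close>, so
  that all four sums in the recurrence run over the same range.\<close>

definition delannoy_sum :: "nat \<Rightarrow> nat \<Rightarrow> nat \<Rightarrow> 'a::comm_ring_1 poly" where
  "delannoy_sum N a b =
     (\<Sum>k\<le>N. binom_monom a k * binom_monom b k * ([:0, 1:] ^ 2 + [:0, 1:]) ^ k)"

text \<open>The defect of each single term is a difference of consecutive values of the last
  summand, so only the value at the cut-off survives. It vanishes as soon as \<open>N\<close>
  exceeds \<open>a\<close> or \<open>b\<close>.\<close>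

lemma delannoy_sum_Suc_Suc:
  "[:0, 1:] * (delannoy_sum N a (Suc b) + delannoy_sum N (Suc a) b + delannoy_sum N a b) =
     delannoy_sum N (Suc a) (Suc b) +
     binom_monom a N * binom_monom b N * ([:0, 1:] ^ 2 + [:0, 1:]) ^ Suc N"
proof -
  define x :: "'a poly" where "x = [:0, 1:]"
  \<comment> \<open>Here \<open>A\<close>, \<open>A'\<close> stand for
    \<open>binom_monom a (Suc N)\<close> and \<open>binom_monom a N\<close>, similarly
    \<open>B\<close>, \<open>B'\<close> for \<open>b\<close>, and \<open>p\<close> for
    \<open>(x ^ 2 + x) ^ Suc N\<close>. The last summands on the two sides are the old and the new
    defect.\<close>
  have telescope: "x * (A * (x * B + B') * p + (x * A + A') * B * p + A * B * p) + A' * B' * p =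
      (x * A + A') * (x * B + B') * p + A * B * ((x ^ 2 + x) * p)" for A A' B B' p
    by (simp add: algebra_simps power2_eq_square)
  \<comment> \<open>The \<open>S\<close>'s are the sums up to \<open>N\<close>, the
    \<open>t1\<close> to \<open>t4\<close> the terms at \<open>Suc N\<close>, and \<open>e\<close>
    and \<open>t5\<close> the old and the new defect.\<close>
  have combine: "x * ((S1 + t1) + (S2 + t2) + (S3 + t3)) = (S4 + t4) + t5"
    if "x * (S1 + S2 + S3) = S4 + e" "x * (t1 + t2 + t3) + e = t4 + t5"
    for S1 S2 S3 S4 t1 t2 t3 t4 t5 e
  proof -
    have "x * ((S1 + t1) + (S2 + t2) + (S3 + t3)) = x * (S1 + S2 + S3) + x * (t1 + t2 + t3)"
      by (simp add: algebra_simps)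
    also have "\<dots> = S4 + (x * (t1 + t2 + t3) + e)"
      unfolding that(1) by (simp only: ac_simps)
    finally show ?thesis
      unfolding that(2) by (simp only: ac_simps)
  qed
  show ?thesis
    unfolding delannoy_sum_def x_def [symmetric]
  proof (induction N)
    case 0
    show ?case
      by (simp add: binom_monom_0_right x_def [symmetric] algebra_simps power2_eq_square)
  next
    case (Suc N)
    show ?case
      unfolding sum.atMost_Suc binom_monom_Suc_Suc x_def [symmetric]
        power_Suc[of "x ^ 2 + x" "Suc N"]
      by (rule combine[OF Suc telescope])
  qed
qed

lemma delannoy_sum_0_left: "delannoy_sum N 0 b = [:0, 1:] ^ b"
  unfolding delannoy_sum_def
  by (subst sum.mono_neutral_right[of _ "{0}"])
    (auto simp: binom_monom_eq_0 binom_monom_0_right)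

lemma delannoy_sum_0_right: "delannoy_sum N a 0 = [:0, 1:] ^ a"
  unfolding delannoy_sum_def
  by (subst sum.mono_neutral_right[of _ "{0}"])
    (auto simp: binom_monom_eq_0 binom_monom_0_right)

lemma delannoy_poly_eq_sum:
  assumes "a \<le> N"
  shows "delannoy_poly a b = (delannoy_sum N a b :: 'a::comm_ring_1 poly)"
  using assms
proof (induction a arbitrary: b)
  case 0
  show ?case
    by (induction b)
      (simp_all only: delannoy_poly_0_0 delannoy_poly_0_Suc delannoy_sum_0_left power_0 power_Suc)
next
  case (Suc a)
  then have IH: "delannoy_poly a b = (delannoy_sum N a b :: 'a poly)" for b
    by simp
  show ?case
  proof (induction b)
    case 0
    show ?case
      by (simp only: delannoy_poly_Suc_0 IH delannoy_sum_0_right power_Suc)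
  next
    case (Suc b)
    \<comment> \<open>Since \<open>a < N\<close>, the factor \<open>binom_monom a N\<close> kills
      the defect.\<close>
    show ?case
      using \<open>Suc a \<le> N\<close>
      by (simp only: delannoy_poly_Suc_Suc IH Suc delannoy_sum_Suc_Suc binom_monom_eq_0[of a N]
          Suc_le_eq mult_zero_left add_0_right)
  qed
qed

subsection \<open>Coefficients of the series\<close>

text \<open>Differentiation shifts the sequence \<open>fact n * fps_nth f n\<close> by one
  place.\<close>

lemma fact_mult_fps_nth_deriv_nth:
  "fact n * fps_nth (fps_nth_deriv k f) n =
     fact (n + k) * fps_nth (f :: 'a::{comm_semiring_1,semiring_char_0} fps) (n + k)"
proof (induction k arbitrary: f)
  case (Suc k)
  have "fact n * fps_nth (fps_nth_deriv (Suc k) f) n = fact (n + k) * fps_nth (fps_deriv f) (n + k)"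
    using Suc[of "fps_deriv f"] by simp
  also have "\<dots> = fact (n + Suc k) * fps_nth f (n + Suc k)"
    by (simp add: ac_simps)
  finally show ?case .
qed simp

lemma psi_Suc_nth:
  "fps_nth (psi (Suc k) :: 'a::field_char_0 fps) n = 1 / (fact n * of_nat (Suc (n + k)))"
proof -
  define m where "m = n + k"
  \<comment> \<open>The coefficient of z^m in (e^z - 1) / z is
    \<open>1 / fact (Suc m)\<close>.\<close>
  have "fact n * fps_nth (psi (Suc k)) n = fact m * (1 / fact (Suc m) :: 'a)"
    by (simp add: psi_def fact_mult_fps_nth_deriv_nth fps_exp_def m_def)
  also have "\<dots> = 1 / of_nat (Suc m)"
    by (simp only: fact_Suc) (simp add: field_simps del: of_nat_Suc)
  finally show ?thesis
    by (simp add: field_simps m_def del: of_nat_Suc)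
qed

lemma psi_scaled_nth: "fps_nth (psi_scaled m) n = [:fps_nth (psi m) n:] * [:0, 1:] ^ n"
  \<comment> \<open>The swap gives the inner series the shape of a constant times the variable, so
    composition scales the n-th coefficient by x^n.\<close>
  unfolding psi_scaled_def mult.commute[of fps_X] fps_compose_linear
  by (simp add: mult.commute)

definition delannoy_term :: "nat \<Rightarrow> 'a::field_char_0 poly fps fps" where
  "delannoy_term k = var_u * var_v *
     ((var_u * var_v * (var_x ^ 2 + var_x)) ^ k * scalar (1 / (fact k) ^ 2) *
      series_in_u (psi_scaled (k + 1)) * series_in_v (psi_scaled (k + 1)))"

text \<open>Each variable occurs with exponent at least \<open>k + 1\<close>: \<open>k\<close> from
  the power and one from the prefactor \<open>var_u * var_v\<close>.\<close>

lemma delannoy_term_nth: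
  "fps_nth (fps_nth (delannoy_term k :: 'a::field_char_0 poly fps fps) i) j =
     (if i \<le> k \<or> j \<le> k then 0
      else [:1 / (fact k) ^ 2:] * ([:0, 1:] ^ 2 + [:0, 1:]) ^ k *
        fps_nth (psi_scaled (Suc k)) (i - Suc k) * fps_nth (psi_scaled (Suc k)) (j - Suc k))"
proof -
  define y :: "'a poly" where "y = [:0, 1:] ^ 2 + [:0, 1:]"
  define c :: "'a poly" where "c = [:1 / (fact k) ^ 2:]"
  define P :: "'a poly fps" where "P = psi_scaled (Suc k)"
  have y: "var_x ^ 2 + var_x = fps_const (fps_const y)"
    by (simp only: var_x_def y_def fps_const_power fps_const_add)
  \<comment> \<open>All factors free of u are gathered in one \<open>fps_const\<close>, which leaves
    a plain shift in each variable.\<close>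
  have "delannoy_term k = fps_X ^ Suc k *
      (fps_const (fps_X ^ Suc k * (fps_const (c * y ^ k) * P)) * series_in_u P)"
    unfolding delannoy_term_def y var_u_def var_v_def scalar_def series_in_v_def
      c_def [symmetric] Suc_eq_plus1 [symmetric] P_def [symmetric]
    by (simp add: power_mult_distrib ac_simps flip: fps_const_mult fps_const_power)
  then show ?thesis
    unfolding y_def [symmetric] c_def [symmetric] P_def [symmetric]
    by (simp add: fps_X_power_mult_nth series_in_u_def less_Suc_eq_le mult.assoc del: power_Suc)
qed

lemma delannoy_term_nth_Suc_Suc:
  "fps_nth (fps_nth (delannoy_term k :: 'a::field_char_0 poly fps fps) (Suc a)) (Suc b) =
     [:1 / (fact (Suc a) * fact (Suc b)):] *
       (binom_monom a k * binom_monom b k * ([:0, 1:] ^ 2 + [:0, 1:]) ^ k)"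
proof (cases "k \<le> a \<and> k \<le> b")
  case True
  \<comment> \<open>At index \<open>n - k\<close> the denominator factor
    \<open>Suc (n - k + k)\<close> is \<open>Suc n\<close>, so the coefficient of
    \<open>psi (Suc k)\<close> is a multiple of \<open>n choose k\<close>.\<close>
  have *: "fps_nth (psi_scaled (Suc k)) (n - k) =
      [:fact k / fact (Suc n) :: 'a:] * binom_monom n k" if "k \<le> n" for n
  proof -
    have "of_nat (n choose k) = [:of_nat (n choose k) :: 'a:]"
      by (simp add: of_nat_poly)
    moreover have "1 / (fact (n - k) * of_nat (Suc n)) =
        fact k / fact (Suc n) * (of_nat (n choose k) :: 'a)"
      using that by (simp add: binomial_fact field_simps del: of_nat_Suc)
    ultimately show ?thesis
      using that by (simp add: psi_scaled_nth psi_Suc_nth binom_monom_def mult.commute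
          del: of_nat_Suc fact_Suc)
  qed
  \<comment> \<open>The two factors \<open>fact k\<close>, one from each variable, cancel the scalar
    of the term.\<close>
  have "[:1 / (fact k) ^ 2:] * [:fact k / fact (Suc a):] * [:fact k / fact (Suc b):] =
      [:1 / (fact (Suc a) * fact (Suc b)) :: 'a:]"
    by (simp add: field_simps power2_eq_square del: fact_Suc)
  then show ?thesis
    using True by (simp only: delannoy_term_nth diff_Suc_Suc * Suc_le_eq) (simp add: ac_simps)
next
  case False
  then show ?thesis
    by (auto simp: delannoy_term_nth binom_monom_eq_0 not_le)
qed

theorem theorem8p4:
  shows "(\<lambda>k. var_u * var_v *
            ((var_u * var_v * (var_x ^ 2 + var_x)) ^ k * scalar (1 / (fact k) ^ 2) *
             series_in_u (psi_scaled (k + 1)) * series_in_v (psi_scaled (k + 1))))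
         sums (delannoy_series :: 'a::field_char_0 poly fps fps)"
proof -
  \<comment> \<open>Term \<open>k\<close> starts at u^(k + 1), so the coefficient of u^i, a whole
    series in v, is final once \<open>i \<le> N\<close>. This is convergence in the u-adic
    metric.\<close>
  have "fps_nth (\<Sum>k\<le>N. delannoy_term k) i = fps_nth (delannoy_series :: 'a poly fps fps) i"
    if "i \<le> N" for i N
  proof (rule fps_ext)
    fix j
    show "fps_nth (fps_nth (\<Sum>k\<le>N. delannoy_term k) i) j =
        fps_nth (fps_nth (delannoy_series :: 'a poly fps fps) i) j"
    proof (cases "i = 0 \<or> j = 0")
      case True
      then show ?thesis
        by (auto simp: fps_sum_nth delannoy_term_nth delannoy_series_def)
    next
      case False
      then obtain a b where ab: "i = Suc a" "j = Suc b"
        by (meson not0_implies_Suc)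
      define c :: "'a poly" where "c = [:1 / (fact (Suc a) * fact (Suc b)):]"
      have "fps_nth (fps_nth (\<Sum>k\<le>N. delannoy_term k) i) j = c * delannoy_sum N a b"
        by (simp only: ab fps_sum_nth delannoy_term_nth_Suc_Suc c_def delannoy_sum_def
            sum_distrib_left)
      also have "\<dots> = c * delannoy_poly a b"
        using that ab by (simp add: delannoy_poly_eq_sum[of a N])
      also have "\<dots> = fps_nth (fps_nth delannoy_series i) j"
        by (simp add: ab delannoy_series_def c_def del: fact_Suc)
      finally show ?thesis .
    qed
  qed
  then have "(\<lambda>N. \<Sum>k\<le>N. delannoy_term k) \<longlonglongrightarrow> (delannoy_series :: 'a poly fps fps)"
    by (intro tendsto_fpsI eventually_sequentiallyI)
  then show ?thesis
    by (simp only: sums_def_le delannoy_term_def)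
qed

end
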